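(* Let $d\ge 1$, let $I$ be the left ideal of differential operators in the variables $x_{ij}$ $(1\le i\le j\le d+1)$, $y_1,\dots,y_{d+1}$, $r$ defined in the context, and let $F=(1,\partial_1,\dots,\partial_{d+1},\partial_1^2,\dots,\partial_d^2)^T$. Then for each $i\in\{1,\dots,d+1\}$ there exists a $(2d+2)\times(2d+2)$ matrix $H_i$ with entries in the field of rational functions $\mathbf{Q}(x,y,r)$ which has a factored form (defined in the context) and satisfies $\partial_i F\equiv H_iF \bmod I$, where $\partial_iF=(\partial_i,\partial_i\partial_1,\dots,\partial_i\partial_{d+1},\partial_i\partial_1^2,\dots,\partial_i\partial_d^2)^T$ and the congruence holds entrywise.
   Context: Variables: $x_{ij}$ for $1\le i\le j\le d+1$, $y_i$ for $1\le i\le d+1$, and $r$; write $x_{ji}=x_{ij}$. Put $\partial_{ij}=\partial/\partial x_{ij}$, $\partial_i=\partial/\partial y_i$, $\partial_r=\partial/\partial r$. $I$ is the left ideal generated by the following differential operators: (1) $\partial_{ij}-\partial_i\partial_j$ $(1\le i\le j\le d+1)$; (2) $\sum_{i=1}^{d+1}\partial_i^2-r^2$; (3) $x_{ij}\partial_i^2+2(x_{jj}-x_{ii})\partial_i\partial_j-x_{ij}\partial_j^2+\sum_{1\le k\le d+1,\,k\ne i,j}(x_{kj}\partial_i\partial_k-x_{ik}\partial_j\partial_k)+y_j\partial_i-y_i\partial_j$ $(1\le i<j\le d+1)$; (4) $r\partial_r-2\sum_{1\le i\le j\le d+1}x_{ij}\partial_i\partial_j-\sum_{i=1}^{d+1}y_i\partial_i-d$.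 (These operators annihilate the Fisher--Bingham normalizing constant $Z(x,y,r)=\int_{S^d(r)}\exp(\sum_{i\le j}x_{ij}t_it_j+\sum_i y_it_i)\,|dt|$.) For vectors $s,t$ of differential operators, $s\equiv t \bmod I$ means that each entry of $s-t$ belongs to the left ideal generated by the operators (1)--(4) in the ring of differential operators with coefficients in $\mathbf{Q}(x,y,r)$. Factored form: a $(2d+2)\times(2d+2)$ matrix with entries in $\mathbf{Q}(x,y,r)$ has a factored form if it can be written as a finite sum $\sum_j R_j^{-1}Q_jT_j^{-1}S_j\cdots$ of finite products, where $R_j,Q_j,T_j,S_j,\dots$ are $(2d+2)\times(2d+2)$ matrices with polynomial entries and the matrices that are inverted are invertible over $\mathbf{Q}(x,y,r)$. *)

theory Defs
  imports
    "HOL-Library.Poly_Mapping"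
    "HOL-Library.Uprod"
    "HOL-Library.Countable"
    "HOL-Library.Cardinality"
    "HOL-Computational_Algebra.Fraction_Field"
    "Jordan_Normal_Form.Matrix"
begin

section \<open>Variables, polynomials and rational functions\<close>

text \<open>
  The index set \<open>{1, ..., d + 1}\<close> is a finite linearly ordered type \<open>'n\<close> with \<open>d + 1\<close>
  elements. The variables \<open>x\<^sub>i\<^sub>j\<close> are indexed by unordered pairs, so that there is exactly one
  variable for \<open>i \<le> j\<close> and \<open>x\<^sub>j\<^sub>i = x\<^sub>i\<^sub>j\<close> holds by construction.
\<close>

datatype 'n var = Var_x "'n uprod" | Var_y 'n | Var_r

instance var :: (finite) finite
proof
  have "finite (UNIV :: 'a uprod set)"
    by simp
  moreover have "(UNIV :: 'a var set) \<subseteq> Var_x ` UNIV \<union> Var_y ` UNIV \<union> {Var_r}"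
  proof
    fix v :: "'a var"
    show "v \<in> Var_x ` UNIV \<union> Var_y ` UNIV \<union> {Var_r}"
      by (cases v) auto
  qed
  ultimately show "finite (UNIV :: 'a var set)"
    by (elim finite_subset) simp
qed

text \<open>
  An arbitrary linear order on the variables; it only serves to make the type of polynomials an
  instance of \<^class>\<open>idom\<close>, which is needed to form the field of fractions.
\<close>

instantiation var :: (finite) linorder
begin

definition less_eq_var :: "'n::finite var \<Rightarrow> 'n var \<Rightarrow> bool"
  where "less_eq_var v w \<longleftrightarrow> to_nat v \<le> to_nat w"

definition less_var :: "'n::finite var \<Rightarrow> 'n var \<Rightarrow> bool"
  where "less_var v w \<longleftrightarrow> to_nat v < to_nat w"

instance
  by standard (auto simp: less_eq_var_def less_var_def)

end

type_synonym 'n mpoly = "('n var \<Rightarrow>\<^sub>0 nat) \<Rightarrow>\<^sub>0 rat"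
type_synonym 'n ratfun = "'n mpoly fract"

definition poly_fun :: "'n::finite mpoly \<Rightarrow> 'n ratfun"
  where "poly_fun p = Fract p 1"

definition var_fun :: "'n::finite var \<Rightarrow> 'n ratfun"
  where "var_fun v = poly_fun (Poly_Mapping.single (Poly_Mapping.single v 1) 1)"


section \<open>Partial derivatives\<close>

definition mono_deriv :: "'n::finite var \<Rightarrow> ('n var \<Rightarrow>\<^sub>0 nat) \<Rightarrow> rat \<Rightarrow> 'n mpoly"
  where "mono_deriv v m c =
    Poly_Mapping.single (m - Poly_Mapping.single v 1) (c * of_nat (Poly_Mapping.lookup m v))"

definition poly_deriv :: "'n::finite var \<Rightarrow> 'n mpoly \<Rightarrow> 'n mpoly"
  where "poly_deriv v p = (\<Sum>m\<in>Poly_Mapping.keys p. mono_deriv v m (Poly_Mapping.lookup p m))"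

lemma mono_deriv_0 [simp]: "mono_deriv v m 0 = 0"
  by (simp add: mono_deriv_def)

lemma mono_deriv_add: "mono_deriv v m (a + b) = mono_deriv v m a + mono_deriv v m b"
  by (simp add: mono_deriv_def single_add distrib_right)

lemma poly_deriv_superset:
  assumes "finite S" "Poly_Mapping.keys p \<subseteq> S"
  shows "poly_deriv v p = (\<Sum>m\<in>S. mono_deriv v m (Poly_Mapping.lookup p m))"
  unfolding poly_deriv_def using assms
  by (intro sum.mono_neutral_left) (auto simp: in_keys_iff)

lemma poly_deriv_0 [simp]: "poly_deriv v 0 = 0"
  by (simp add: poly_deriv_def)

lemma poly_deriv_add: "poly_deriv v (p + q) = poly_deriv v p + poly_deriv v q"
proof -
  let ?S = "Poly_Mapping.keys p \<union> Poly_Mapping.keys q"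
  have "poly_deriv v (p + q) = (\<Sum>m\<in>?S. mono_deriv v m (Poly_Mapping.lookup (p + q) m))"
    using keys_add[of p q] by (intro poly_deriv_superset) auto
  also have "\<dots> = (\<Sum>m\<in>?S. mono_deriv v m (Poly_Mapping.lookup p m)) + (\<Sum>m\<in>?S. mono_deriv v m (Poly_Mapping.lookup q m))"
    by (simp add: lookup_add mono_deriv_add sum.distrib)
  also have "\<dots> = poly_deriv v p + poly_deriv v q"
    by (simp add: poly_deriv_superset[of ?S])
  finally show ?thesis .
qed

lemma poly_deriv_single: "poly_deriv v (Poly_Mapping.single m c) = mono_deriv v m c"
  by (subst poly_deriv_superset[of "{m}"]) auto

lemma poly_mapping_add_induct [case_names zero add]:
  fixes p :: "'a \<Rightarrow>\<^sub>0 'b::comm_monoid_add"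
  assumes "P 0" "\<And>m c p. P p \<Longrightarrow> P (Poly_Mapping.single m c + p)"
  shows "P p"
proof (induction p rule: update_induct)
  case const
  show ?case
    unfolding zero_poly_mapping_def[symmetric] by (rule assms(1))
next
  case (update p a b)
  have "Poly_Mapping.lookup p a = 0"
    using update(1) by (simp only: in_keys_iff not_not)
  then have "Poly_Mapping.lookup (Poly_Mapping.update a b p) k = Poly_Mapping.lookup (Poly_Mapping.single a b + p) k" for k
    by (cases "k = a") (simp_all add: lookup_add lookup_single lookup_update)
  then have "Poly_Mapping.update a b p = Poly_Mapping.single a b + p"
    by (rule poly_mapping_eqI)
  with assms(2)[OF update(3)] show ?case
    by (simp only:)
qed

lemma mono_deriv_mult:
  "poly_deriv v (Poly_Mapping.single m a * Poly_Mapping.single n b) =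
     mono_deriv v m a * Poly_Mapping.single n b + Poly_Mapping.single m a * mono_deriv v n b"
proof -
  have *: "(k - Poly_Mapping.single v 1) + l = k + l - Poly_Mapping.single v 1"
    if "Poly_Mapping.lookup k v \<noteq> 0" for k l :: "'a::finite var \<Rightarrow>\<^sub>0 nat"
    using that by (intro poly_mapping_eqI) (auto simp: lookup_add lookup_minus lookup_single when_def)
  have 1: "mono_deriv v m a * Poly_Mapping.single n b =
      Poly_Mapping.single (m + n - Poly_Mapping.single v 1) (a * b * of_nat (Poly_Mapping.lookup m v))"
    using *[of m n] by (cases "Poly_Mapping.lookup m v = 0") (auto simp: mono_deriv_def mult_single ac_simps)
  have 2: "Poly_Mapping.single m a * mono_deriv v n b =
      Poly_Mapping.single (m + n - Poly_Mapping.single v 1) (a * b * of_nat (Poly_Mapping.lookup n v))"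
    using *[of n m] by (cases "Poly_Mapping.lookup n v = 0") (auto simp: mono_deriv_def mult_single ac_simps)
  show ?thesis
    unfolding 1 2 mult_single poly_deriv_single
    by (simp add: mono_deriv_def lookup_add single_add[symmetric] distrib_left)
qed

lemma poly_deriv_mult: "poly_deriv v (p * q) = poly_deriv v p * q + p * poly_deriv v q"
proof (induction p rule: poly_mapping_add_induct)
  case (add m c p)
  have "poly_deriv v (Poly_Mapping.single m c * q) =
      mono_deriv v m c * q + Poly_Mapping.single m c * poly_deriv v q"
  proof (induction q rule: poly_mapping_add_induct)
    case (add n b q)
    then show ?case
      by (simp add: distrib_left poly_deriv_add mono_deriv_mult poly_deriv_single algebra_simps)
  qed simp
  with add show ?case
    by (simp add: distrib_right poly_deriv_add poly_deriv_single algebra_simps)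
qed simp

lift_definition ratfun_deriv :: "'n::finite var \<Rightarrow> 'n ratfun \<Rightarrow> 'n ratfun"
  is "\<lambda>v f. (poly_deriv v (fst f) * snd f - fst f * poly_deriv v (snd f), snd f * snd f)"
proof -
  fix v :: "'n var" and f g :: "'n mpoly \<times> 'n mpoly"
  assume "fractrel f g"
  then obtain a b c e where f: "f = (a, b)" and g: "g = (c, e)"
    and nz: "b \<noteq> 0" "e \<noteq> 0" and eq: "a * e = c * b"
    by (cases f; cases g) auto
  let ?D = "poly_deriv v"
  have "?D a * e + a * ?D e = ?D c * b + c * ?D b"
    using arg_cong[OF eq, of ?D] by (simp add: poly_deriv_mult)
  then have 1: "?D a * e - c * ?D b = ?D c * b - a * ?D e"
    by (simp add: algebra_simps)
  have "(?D a * b - a * ?D b) * (e * e) = (?D a * e) * (b * e) - (a * e) * (?D b * e)"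
    by (simp add: algebra_simps)
  also have "\<dots> = (?D a * e - c * ?D b) * (b * e)"
    unfolding eq by (simp add: algebra_simps)
  also have "\<dots> = (?D c * b - a * ?D e) * (b * e)"
    unfolding 1 ..
  also have "\<dots> = (?D c * e) * (b * b) - (a * e) * (?D e * b)"
    by (simp add: algebra_simps)
  also have "\<dots> = (?D c * e - c * ?D e) * (b * b)"
    unfolding eq by (simp add: algebra_simps)
  finally show "fractrel (?D (fst f) * snd f - fst f * ?D (snd f), snd f * snd f)
     (?D (fst g) * snd g - fst g * ?D (snd g), snd g * snd g)"
    using nz by (simp add: f g)
qed

lemma ratfun_deriv_Fract:
  "q \<noteq> 0 \<Longrightarrow>
    ratfun_deriv v (Fract p q) = Fract (poly_deriv v p * q - p * poly_deriv v q) (q * q)"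
  by (simp only: Fract.abs_eq if_False ratfun_deriv.abs_eq fractrel_iff fst_conv snd_conv
      mult_eq_0_iff simp_thms)

lemma ratfun_deriv_add_aux:
  fixes a b c e a' b' c' e' :: "'a::comm_ring_1"
  shows "((a' * e + a * e' + (c' * b + c * b')) * (b * e) - (a * e + c * b) * (b' * e + b * e')) *
      (b * b * (e * e)) =
      ((a' * b - a * b') * (e * e) + (c' * e - c * e') * (b * b)) * (b * e * (b * e))"
  by (simp add: algebra_simps)

lemma ratfun_deriv_add: "ratfun_deriv v (f + g) = ratfun_deriv v f + ratfun_deriv v g"
proof (cases f, cases g)
  fix a b c e :: "'a mpoly"
  assume f: "f = Fract a b" "b \<noteq> 0" and g: "g = Fract c e" "e \<noteq> 0"
  have nz: "b * e \<noteq> 0" "b * b \<noteq> 0" "e * e \<noteq> 0" "b * e * (b * e) \<noteq> 0" "b * b * (e * e) \<noteq> 0"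
    using f(2) g(2) by (simp_all only: mult_eq_0_iff simp_thms)
  show ?thesis
    unfolding f(1) g(1) ratfun_deriv_Fract[OF f(2)] ratfun_deriv_Fract[OF g(2)]
      add_fract[OF f(2) g(2)] ratfun_deriv_Fract[OF nz(1)]
      poly_deriv_add poly_deriv_mult add_fract[OF nz(2,3)]
    by (subst eq_fract(1)) (rule nz ratfun_deriv_add_aux)+
qed

lemma ratfun_deriv_mult_aux:
  fixes a b c e a' b' c' e' :: "'a::comm_ring_1"
  shows "((a' * c + a * c') * (b * e) - a * c * (b' * e + b * e')) * (b * b * e * (b * (e * e))) =
      ((a' * b - a * b') * c * (b * (e * e)) + a * (c' * e - c * e') * (b * b * e)) *
      (b * e * (b * e))"
  by (simp add: algebra_simps)

lemma ratfun_deriv_mult: "ratfun_deriv v (f * g) = ratfun_deriv v f * g + f * ratfun_deriv v g"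
proof (cases f, cases g)
  fix a b c e :: "'a mpoly"
  assume f: "f = Fract a b" "b \<noteq> 0" and g: "g = Fract c e" "e \<noteq> 0"
  have nz: "b * e \<noteq> 0" "b * b \<noteq> 0" "e * e \<noteq> 0" "b * e * (b * e) \<noteq> 0" "b * b * e * (b * (e * e)) \<noteq> 0"
    "b * b * e \<noteq> 0" "b * (e * e) \<noteq> 0"
    using f(2) g(2) by (simp_all only: mult_eq_0_iff simp_thms)
  show ?thesis
    unfolding f(1) g(1) ratfun_deriv_Fract[OF f(2)] ratfun_deriv_Fract[OF g(2)]
      mult_fract ratfun_deriv_Fract[OF nz(1)]
      poly_deriv_add poly_deriv_mult add_fract[OF nz(6,7)]
    by (subst eq_fract(1)) (rule nz ratfun_deriv_mult_aux)+
qed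

lemma ratfun_deriv_var: "ratfun_deriv v (var_fun w) = (if v = w then 1 else 0)"
proof -
  have "poly_deriv v 1 = 0"
    using poly_deriv_single[of v 0 1] by (simp add: mono_deriv_def)
  then show ?thesis
    by (auto simp: var_fun_def poly_fun_def ratfun_deriv_Fract poly_deriv_single mono_deriv_def
        lookup_single One_fract_def Zero_fract_def)
qed


section \<open>The ring of differential operators with rational function coefficients\<close>

text \<open>
  Differential operators are realised as operators on the field of rational functions: the ring is
  generated under addition and composition by the multiplications by rational functions and the
  partial derivatives. In characteristic \<open>0\<close> the action on rational functions is faithful, so this
  is the ring of all expressions \<open>\<Sum>\<^sub>\<alpha> c\<^sub>\<alpha> \<partial>\<^sup>\<alpha>\<close> subject to \<open>\<partial>\<^sub>v c = c \<partial>\<^sub>v + \<partial>c/\<partial>v\<close>.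
\<close>

inductive_set diffops :: "('n::finite ratfun \<Rightarrow> 'n ratfun) set" where
  mult: "(\<lambda>f. c * f) \<in> diffops"
| deriv: "ratfun_deriv v \<in> diffops"
| add: "P \<in> diffops \<Longrightarrow> Q \<in> diffops \<Longrightarrow> (\<lambda>f. P f + Q f) \<in> diffops"
| comp: "P \<in> diffops \<Longrightarrow> Q \<in> diffops \<Longrightarrow> (\<lambda>f. P (Q f)) \<in> diffops"

lemma diffops_zero: "(\<lambda>f :: 'n::finite ratfun. 0) \<in> diffops"
proof -
  have *: "(\<lambda>f :: 'n ratfun. 0) = (\<lambda>f. 0 * f)"
    by (rule ext) simp
  show ?thesis
    by (subst *) (rule diffops.mult)
qed

lemma diffops_one: "(\<lambda>f :: 'n::finite ratfun. f) \<in> diffops"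
proof -
  have *: "(\<lambda>f :: 'n ratfun. f) = (\<lambda>f. 1 * f)"
    by (rule ext) simp
  show ?thesis
    by (subst *) (rule diffops.mult)
qed

lemma diffops_uminus: "P \<in> diffops \<Longrightarrow> (\<lambda>f. - P f) \<in> diffops"
  using diffops.comp[OF diffops.mult[of "-1"], of P] by simp

lemma diffops_diff:
  assumes "P \<in> diffops" "Q \<in> diffops"
  shows "(\<lambda>f. P f - Q f) \<in> diffops"
  using diffops.add[OF assms(1) diffops_uminus[OF assms(2)]] by simp

lemma diffops_additive: "P \<in> diffops \<Longrightarrow> P (f + g) = P f + P g"
  by (induction arbitrary: f g rule: diffops.induct)
    (simp_all add: distrib_left ratfun_deriv_add add_ac)

typedef (overloaded) 'n diffop = "diffops :: ('n::finite ratfun \<Rightarrow> 'n ratfun) set"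
  morphisms apply_op Abs_diffop
  using diffops_zero by blast

setup_lifting type_definition_diffop

instantiation diffop :: (finite) ring_1
begin

lift_definition zero_diffop :: "'n::finite diffop" is "\<lambda>f. 0" by (rule diffops_zero)
lift_definition one_diffop :: "'n::finite diffop" is "\<lambda>f. f" by (rule diffops_one)
lift_definition plus_diffop :: "'n::finite diffop \<Rightarrow> 'n diffop \<Rightarrow> 'n diffop"
  is "\<lambda>P Q f. P f + Q f" by (rule diffops.add)
lift_definition uminus_diffop :: "'n::finite diffop \<Rightarrow> 'n diffop"
  is "\<lambda>P f. - P f" by (rule diffops_uminus)
lift_definition minus_diffop :: "'n::finite diffop \<Rightarrow> 'n diffop \<Rightarrow> 'n diffop"
  is "\<lambda>P Q f. P f - Q f" by (rule diffops_diff)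
lift_definition times_diffop :: "'n::finite diffop \<Rightarrow> 'n diffop \<Rightarrow> 'n diffop"
  is "\<lambda>P Q f. P (Q f)" by (rule diffops.comp)

instance
proof
  fix P Q S :: "'a diffop"
  note defs = apply_op_inject[symmetric] fun_eq_iff zero_diffop.rep_eq one_diffop.rep_eq
    plus_diffop.rep_eq uminus_diffop.rep_eq minus_diffop.rep_eq times_diffop.rep_eq
  show "P + Q + S = P + (Q + S)" "P + Q = Q + P" "0 + P = P" "- P + P = 0" "P - Q = P + - Q"
    "P * Q * S = P * (Q * S)" "1 * P = P" "P * 1 = P" "(P + Q) * S = P * S + Q * S"
    by (simp_all add: defs add.assoc add.commute)
  show "P * (Q + S) = P * Q + P * S"
    by (simp add: defs diffops_additive[OF apply_op])
  show "(0 :: 'a diffop) \<noteq> 1"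
    unfolding defs by (metis zero_neq_one)
qed

end

definition coef :: "'n::finite ratfun \<Rightarrow> 'n diffop"
  where "coef c = Abs_diffop (\<lambda>f. c * f)"

definition pd :: "'n::finite var \<Rightarrow> 'n diffop"
  where "pd v = Abs_diffop (ratfun_deriv v)"

lemma apply_coef: "apply_op (coef c) f = c * f"
  unfolding coef_def by (subst Abs_diffop_inverse) (rule diffops.mult refl)+

lemma apply_pd: "apply_op (pd v) f = ratfun_deriv v f"
  unfolding pd_def by (subst Abs_diffop_inverse) (rule diffops.deriv refl)+

lemma pd_coef: "pd v * coef c = coef c * pd v + coef (ratfun_deriv v c)"
  unfolding apply_op_inject[symmetric] fun_eq_iff times_diffop.rep_eq plus_diffop.rep_eq
    apply_coef apply_pd ratfun_deriv_mult by (simp only: add.commute simp_thms)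


section \<open>Left ideals and the Fisher--Bingham ideal\<close>

definition left_ideal :: "'a::ring_1 set \<Rightarrow> bool"
  where "left_ideal J \<longleftrightarrow>
    0 \<in> J \<and> (\<forall>a\<in>J. \<forall>b\<in>J. a + b \<in> J) \<and> (\<forall>r. \<forall>a\<in>J. r * a \<in> J)"

definition cong_mod :: "'a::ring_1 set \<Rightarrow> 'a vec \<Rightarrow> 'a vec \<Rightarrow> bool"
  where "cong_mod J s t \<longleftrightarrow> dim_vec s = dim_vec t \<and> (\<forall>k<dim_vec s. s $ k - t $ k \<in> J)"

abbreviation dx :: "'n::finite \<Rightarrow> 'n \<Rightarrow> 'n diffop"
  where "dx i j \<equiv> pd (Var_x (Upair i j))"
abbreviation dy :: "'n::finite \<Rightarrow> 'n diffop"
  where "dy i \<equiv> pd (Var_y i)"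
abbreviation dr :: "'n::finite diffop"
  where "dr \<equiv> pd Var_r"
abbreviation x_op :: "'n::finite \<Rightarrow> 'n \<Rightarrow> 'n diffop"
  where "x_op i j \<equiv> coef (var_fun (Var_x (Upair i j)))"
abbreviation y_op :: "'n::finite \<Rightarrow> 'n diffop"
  where "y_op i \<equiv> coef (var_fun (Var_y i))"
abbreviation r_op :: "'n::finite diffop"
  where "r_op \<equiv> coef (var_fun Var_r)"

definition FB_gen1 :: "'n::{finite,linorder} diffop set"
  where "FB_gen1 = {dx i j - dy i * dy j | i j. i \<le> j}"

definition FB_gen2 :: "'n::{finite,linorder} diffop"
  where "FB_gen2 = (\<Sum>i\<in>UNIV. dy i ^ 2) - r_op ^ 2"

definition FB_gen3 :: "'n::{finite,linorder} diffop set"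
  where "FB_gen3 =
    {x_op i j * dy i ^ 2 + 2 * (x_op j j - x_op i i) * dy i * dy j - x_op i j * dy j ^ 2
      + (\<Sum>k\<in>UNIV - {i, j}. x_op k j * dy i * dy k - x_op i k * dy j * dy k)
      + y_op j * dy i - y_op i * dy j | i j. i < j}"

definition FB_gen4 :: "nat \<Rightarrow> 'n::{finite,linorder} diffop"
  where "FB_gen4 d =
    r_op * dr - 2 * (\<Sum>(i, j)\<in>{(i, j). i \<le> j}. x_op i j * dy i * dy j) - (\<Sum>i\<in>UNIV. y_op i * dy i)
      - of_nat d"

text \<open>The intended ideal when \<open>CARD('n) = d + 1\<close>.\<close>

definition FB_ideal :: "nat \<Rightarrow> 'n::{finite,linorder} diffop set"
  where "FB_ideal d = left_ideal hull (FB_gen1 \<union> {FB_gen2} \<union> FB_gen3 \<union> {FB_gen4 d})"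

text \<open>
  The vector \<open>(1, \<partial>\<^sub>1, ..., \<partial>\<^sub>d\<^sub>+\<^sub>1, \<partial>\<^sub>1\<^sup>2, ..., \<partial>\<^sub>d\<^sup>2)\<close>; \<open>butlast\<close> drops the square for the largest index.
\<close>

definition FB_vec :: "'n::{finite,linorder} diffop vec"
  where "FB_vec = (let idx = sorted_list_of_set UNIV in
    vec_of_list (1 # map dy idx @ map (\<lambda>i. dy i ^ 2) (butlast idx)))"


section \<open>Factored forms\<close>

definition poly_mats :: "nat \<Rightarrow> 'n::finite ratfun mat set"
  where "poly_mats N = {M \<in> carrier_mat N N. elements_mat M \<subseteq> range poly_fun}"

text \<open>
  The products \<open>R\<^sup>-\<^sup>1 Q T\<^sup>-\<^sup>1 S \<dots>\<close>. As the identity is a polynomial matrix, the strict alternation is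
  no restriction.
\<close>

inductive_set factored_products :: "nat \<Rightarrow> 'n::finite ratfun mat set" for N where
  single: "A \<in> poly_mats N \<Longrightarrow> A' \<in> carrier_mat N N \<Longrightarrow> inverts_mat A A' \<Longrightarrow> inverts_mat A' A
    \<Longrightarrow> Q \<in> poly_mats N \<Longrightarrow> A' * Q \<in> factored_products N"
| step: "A \<in> poly_mats N \<Longrightarrow> A' \<in> carrier_mat N N \<Longrightarrow> inverts_mat A A' \<Longrightarrow> inverts_mat A' A
    \<Longrightarrow> Q \<in> poly_mats N \<Longrightarrow> P \<in> factored_products N \<Longrightarrow> A' * Q * P \<in> factored_products N"

definition has_factored_form :: "nat \<Rightarrow> 'n::finite ratfun mat \<Rightarrow> bool"
  where "has_factored_form N H \<longleftrightarrow>
    (\<exists>Ps. set Ps \<subseteq> factored_products N \<and> H = foldr (+) Ps (0\<^sub>m N N))"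

end

theory Submission
  imports Defs
begin

text \<open>
  Modulo the ideal, the operators that are \<open>\<rat>(x, y, r)\<close>-linear combinations of the entries of
  \<open>F\<close> form a left subspace, and it suffices that all \<open>\<partial>\<^sub>i\<partial>\<^sub>j\<close> and all \<open>\<partial>\<^sub>i\<partial>\<^sub>j\<partial>\<^sub>k\<close> lie in it. Specialize
  \<open>x\<^sub>i\<^sub>j = 0\<close> for \<open>i \<noteq> j\<close> and the \<open>x\<^sub>i\<^sub>i\<close> to distinct numbers. The leading part of generator (3) becomes
  \<open>2 (x\<^sub>j\<^sub>j - x\<^sub>i\<^sub>i) \<partial>\<^sub>i\<partial>\<^sub>j\<close>, so that the generator and its multiples by \<open>\<partial>\<^sub>k\<close> eliminate every monomial
  containing two different derivatives, and \<open>\<partial>\<^sub>i\<close> times generator (2) then eliminates \<open>\<partial>\<^sub>i\<^sup>3\<close>. Since the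
  linear system is solvable after specialization, it is solvable over \<open>\<rat>(x, y, r)\<close>; this is
  phrased as Nakayama's lemma. Clearing denominators, \<open>H = (q 1)\<^sup>-\<^sup>1 (q H)\<close> is a factored form
  of any matrix \<open>H\<close> of rational functions.
\<close>

section \<open>Nakayama's lemma relative to a specialization\<close>

text \<open>In the application \<open>s\<close> evaluates polynomials at a rational point,
  \<open>e\<close> embeds them as multiplication operators, and \<open>W\<close> is a left subspace
  of operators. The assumption \<open>W_cancel\<close> lets \<open>W\<close> act as a module over
  the local ring at the kernel of \<open>s\<close>, without constructing that ring. The ring
  \<open>'r\<close> is noncommutative, but the values of \<open>e\<close> commute with each
  other.\<close>

locale specialized_module =
  fixes s :: "'a::comm_ring_1 \<Rightarrow> 'b::idom" and e :: "'a \<Rightarrow> 'r::ring_1" and W :: "'r set"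
  assumes s_add: "s (p + q) = s p + s q" and s_mult: "s (p * q) = s p * s q" and s_one: "s 1 = 1"
    and e_add: "e (p + q) = e p + e q" and e_mult: "e (p * q) = e p * e q" and e_one: "e 1 = 1"
    and W_zero: "0 \<in> W" and W_add: "P \<in> W \<Longrightarrow> Q \<in> W \<Longrightarrow> P + Q \<in> W"
    and W_mult: "P \<in> W \<Longrightarrow> e p * P \<in> W"
    and W_cancel: "e p * P \<in> W \<Longrightarrow> s p \<noteq> 0 \<Longrightarrow> P \<in> W"
begin

lemma s_zero: "s 0 = 0"
  using s_add[of 0 0] by (simp only: add_0_left add_cancel_right_right)

lemma e_zero: "e 0 = 0"
  using e_add[of 0 0] by (simp only: add_0_left add_cancel_right_right)

lemma s_uminus: "s (- p) = - s p"
  using s_add[of p "- p"] by (simp add: s_zero eq_neg_iff_add_eq_0 add.commute)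

lemma e_uminus: "e (- p) = - e p"
  using e_add[of p "- p"] by (simp add: e_zero eq_neg_iff_add_eq_0 add.commute)

lemma s_diff: "s (p - q) = s p - s q"
  using s_add[of p "- q"] by (simp add: s_uminus)

lemma e_diff: "e (p - q) = e p - e q"
  using e_add[of p "- q"] by (simp add: e_uminus)

lemma W_uminus: "P \<in> W \<Longrightarrow> - P \<in> W"
  using W_mult[of P "- 1"] by (simp add: e_uminus e_one)

lemma W_diff: "P \<in> W \<Longrightarrow> Q \<in> W \<Longrightarrow> P - Q \<in> W"
  using W_add[of P "- Q"] W_uminus[of Q] by simp

lemma W_sum: "(\<And>i. i \<in> A \<Longrightarrow> f i \<in> W) \<Longrightarrow> sum f A \<in> W"
  by (induction A rule: infinite_finite_induct) (auto intro: W_add W_zero)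

text \<open>The localization at \<open>ker s\<close> of the module \<open>W + (ker s) U\<close>.\<close>

definition residual :: "'r set \<Rightarrow> 'r set"
  where "residual U = {P. \<exists>c a. s c \<noteq> 0 \<and> (\<forall>v\<in>U. s (a v) = 0) \<and>
    e c * P - (\<Sum>v\<in>U. e (a v) * v) \<in> W}"

lemma residualI:
  "s c \<noteq> 0 \<Longrightarrow> (\<And>v. v \<in> U \<Longrightarrow> s (a v) = 0) \<Longrightarrow> e c * P - (\<Sum>v\<in>U. e (a v) * v) \<in> W \<Longrightarrow>
    P \<in> residual U"
  unfolding residual_def by blast

lemma residualE:
  assumes "P \<in> residual U"
  obtains c a where "s c \<noteq> 0" "\<forall>v\<in>U. s (a v) = 0" "e c * P - (\<Sum>v\<in>U. e (a v) * v) \<in> W"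
  using assms unfolding residual_def by blast

lemma residual_W: "P \<in> W \<Longrightarrow> P \<in> residual U"
  by (rule residualI[of 1 _ "\<lambda>_. 0"]) (simp_all add: s_one e_one s_zero e_zero)

lemma residual_add:
  assumes "P \<in> residual U" "Q \<in> residual U"
  shows "P + Q \<in> residual U"
proof -
  obtain c a where c: "s c \<noteq> 0" "\<forall>v\<in>U. s (a v) = 0" "e c * P - (\<Sum>v\<in>U. e (a v) * v) \<in> W"
    using assms(1) by (rule residualE)
  obtain d b where d: "s d \<noteq> 0" "\<forall>v\<in>U. s (b v) = 0" "e d * Q - (\<Sum>v\<in>U. e (b v) * v) \<in> W"
    using assms(2) by (rule residualE)
  \<comment> \<open>Both relations are brought to the common denominator
    \<open>c * d\<close>.\<close>
  have "e d * (e c * P - (\<Sum>v\<in>U. e (a v) * v)) + e c * (e d * Q - (\<Sum>v\<in>U. e (b v) * v)) \<in> W"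
    using c(3) d(3) by (intro W_add W_mult)
  also have "e d * (e c * P - (\<Sum>v\<in>U. e (a v) * v)) + e c * (e d * Q - (\<Sum>v\<in>U. e (b v) * v)) =
      e (c * d) * (P + Q) - (\<Sum>v\<in>U. e (d * a v + c * b v) * v)"
  proof -
    have "e d * (e c * P) = e (c * d) * P"
      by (simp add: e_mult[symmetric] mult.assoc[symmetric] mult.commute)
    moreover have "e c * (e d * Q) = e (c * d) * Q"
      by (simp add: e_mult[symmetric] mult.assoc[symmetric])
    ultimately show ?thesis
      by (simp add: right_diff_distrib distrib_left distrib_right e_add e_mult[of d] e_mult[of c "b _"]
          sum.distrib sum_distrib_left mult.assoc)
  qed
  finally show ?thesis
    using c d by (intro residualI[of "c * d" _ "\<lambda>v. d * a v + c * b v"]) (simp_all add: s_mult s_add)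
qed

lemma residual_mult:
  assumes "P \<in> residual U"
  shows "e p * P \<in> residual U"
proof -
  obtain c a where c: "s c \<noteq> 0" "\<forall>v\<in>U. s (a v) = 0" "e c * P - (\<Sum>v\<in>U. e (a v) * v) \<in> W"
    using assms by (rule residualE)
  have "e p * (e c * P - (\<Sum>v\<in>U. e (a v) * v)) \<in> W"
    using c(3) by (rule W_mult)
  also have "e p * (e c * P - (\<Sum>v\<in>U. e (a v) * v)) = e c * (e p * P) - (\<Sum>v\<in>U. e (p * a v) * v)"
    by (simp add: right_diff_distrib sum_distrib_left e_mult[of p "a _"] mult.assoc)
       (simp add: e_mult[symmetric] mult.assoc[symmetric] mult.commute)
  finally show ?thesis
    using c by (intro residualI[of c _ "\<lambda>v. p * a v"]) (simp_all add: s_mult)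
qed

lemma residual_uminus: "P \<in> residual U \<Longrightarrow> - P \<in> residual U"
  using residual_mult[of P U "- 1"] by (simp add: e_uminus e_one)

lemma residual_diff: "P \<in> residual U \<Longrightarrow> Q \<in> residual U \<Longrightarrow> P - Q \<in> residual U"
  using residual_add[of P U "- Q"] residual_uminus[of Q U] by simp

lemma residual_sum: "(\<And>i. i \<in> A \<Longrightarrow> f i \<in> residual U) \<Longrightarrow> sum f A \<in> residual U"
  by (induction A rule: infinite_finite_induct) (auto intro: residual_add residual_W W_zero)

text \<open>The factor \<open>p\<close> is absorbed into the denominator \<open>c\<close>;
  \<open>s (c * p)\<close> stays nonzero because the target of \<open>s\<close> is a domain.\<close>

lemma residual_cancel:
  assumes "e p * P \<in> residual U" "s p \<noteq> 0"
  shows "P \<in> residual U"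
proof -
  obtain c a where c: "s c \<noteq> 0" "\<forall>v\<in>U. s (a v) = 0"
      "e c * (e p * P) - (\<Sum>v\<in>U. e (a v) * v) \<in> W"
    using assms(1) by (rule residualE)
  with assms(2) show ?thesis
    by (intro residualI[of "c * p" _ a]) (simp_all add: s_mult e_mult mult.assoc)
qed

lemma residual_gen:
  assumes "finite U" "u \<in> U" "s p = 0"
  shows "e p * u \<in> residual U"
proof -
  have "(\<Sum>v\<in>U. e (if v = u then p else 0) * v) = (\<Sum>v\<in>U. if v = u then e p * u else 0)"
    by (intro sum.cong) (simp_all add: e_zero)
  also have "\<dots> = e p * u"
    using assms by simp
  finally show ?thesis
    using assms by (intro residualI[of 1 _ "\<lambda>v. if v = u then p else 0"])
      (auto simp: s_one e_one s_zero W_zero)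
qed

text \<open>The induction is fraction-free Gaussian elimination.\<close>

lemma nakayama:
  assumes "finite U" "U \<subseteq> residual U"
  shows "U \<subseteq> W"
  using assms
proof (induction U rule: finite_induct)
  case (insert u U)
  have "u \<in> residual (insert u U)"
    using insert.prems by simp
  then obtain c a where c: "s c \<noteq> 0" "\<forall>v\<in>insert u U. s (a v) = 0"
      "e c * u - (\<Sum>v\<in>insert u U. e (a v) * v) \<in> W"
    by (rule residualE)
  \<comment> \<open>The pivot: moving the \<open>u\<close> term of the sum to the left changes
    \<open>c\<close> only by an element of the kernel of \<open>s\<close>, so
    \<open>s q = s c\<close>.\<close>
  define q where "q = c - a u"
  have q: "s q \<noteq> 0"
    using c(1,2) by (simp add: q_def s_diff)
  have u: "e q * u - (\<Sum>v\<in>U. e (a v) * v) \<in> W"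
    using c(3) insert.hyps by (simp add: q_def e_diff algebra_simps)
  have "p \<in> residual U" if "p \<in> U" for p
  proof -
    have "p \<in> residual (insert u U)"
      using insert.prems that by auto
    then obtain d b where d: "s d \<noteq> 0" "\<forall>v\<in>insert u U. s (b v) = 0"
        "e d * p - (\<Sum>v\<in>insert u U. e (b v) * v) \<in> W"
      by (rule residualE)
    \<comment> \<open>Scaling the relation for \<open>p\<close> by the pivot and adding
      \<open>e (b u)\<close> times the relation for \<open>u\<close> cancels \<open>u\<close>, since
      \<open>e q\<close> and \<open>e (b u)\<close> commute. The new coefficients still lie in the
      kernel of \<open>s\<close>.\<close>
    have "e q * (e d * p - (\<Sum>v\<in>insert u U. e (b v) * v)) +
        e (b u) * (e q * u - (\<Sum>v\<in>U. e (a v) * v)) \<in> W"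
      using u d(3) by (intro W_add W_mult)
    also have "e q * (e d * p - (\<Sum>v\<in>insert u U. e (b v) * v)) +
        e (b u) * (e q * u - (\<Sum>v\<in>U. e (a v) * v)) =
        e (q * d) * p - (\<Sum>v\<in>U. e (q * b v + b u * a v) * v)"
    proof -
      have "e q * (e (b u) * u) = e (b u) * (e q * u)"
        by (simp add: e_mult[symmetric] mult.assoc[symmetric] mult.commute)
      then show ?thesis
        using insert.hyps
        by (simp add: right_diff_distrib distrib_left distrib_right e_add e_mult sum.distrib
            sum_distrib_left mult.assoc)
    qed
    finally show ?thesis
      using c d q by (intro residualI[of "q * d" _ "\<lambda>v. q * b v + b u * a v"]) (simp_all add: s_mult s_add)
  qed
  then have U: "U \<subseteq> W"
    by (intro insert.IH) blast
  \<comment> \<open>Back substitution: all other generators are in \<open>W\<close>, so the relation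
    for \<open>u\<close> alone remains.\<close>
  then have "(\<Sum>v\<in>U. e (a v) * v) \<in> W"
    by (intro W_sum W_mult) auto
  from W_add[OF u this] have "e q * u \<in> W"
    by simp
  from this q have "u \<in> W"
    by (rule W_cancel)
  with U show ?case
    by simp
qed simp

end

section \<open>Polynomials, rational functions and operators\<close>

definition mono_eval :: "('n::finite var \<Rightarrow> rat) \<Rightarrow> ('n var \<Rightarrow>\<^sub>0 nat) \<Rightarrow> rat"
  where "mono_eval \<sigma> m = (\<Prod>v\<in>UNIV. \<sigma> v ^ Poly_Mapping.lookup m v)"

definition poly_eval :: "('n::finite var \<Rightarrow> rat) \<Rightarrow> 'n mpoly \<Rightarrow> rat"
  where "poly_eval \<sigma> p = (\<Sum>m\<in>Poly_Mapping.keys p. Poly_Mapping.lookup p m * mono_eval \<sigma> m)"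

lemma mono_eval_add: "mono_eval \<sigma> (m + n) = mono_eval \<sigma> m * mono_eval \<sigma> n"
  by (simp add: mono_eval_def lookup_add power_add prod.distrib)

lemma poly_eval_superset:
  assumes "finite S" "Poly_Mapping.keys p \<subseteq> S"
  shows "poly_eval \<sigma> p = (\<Sum>m\<in>S. Poly_Mapping.lookup p m * mono_eval \<sigma> m)"
  unfolding poly_eval_def using assms
  by (intro sum.mono_neutral_left) (auto simp: in_keys_iff)

lemma poly_eval_0: "poly_eval \<sigma> 0 = 0"
  by (simp add: poly_eval_def)

lemma poly_eval_add: "poly_eval \<sigma> (p + q) = poly_eval \<sigma> p + poly_eval \<sigma> q"
proof -
  let ?S = "Poly_Mapping.keys p \<union> Poly_Mapping.keys q"
  have "poly_eval \<sigma> (p + q) = (\<Sum>m\<in>?S. Poly_Mapping.lookup (p + q) m * mono_eval \<sigma> m)"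
    using keys_add[of p q] by (intro poly_eval_superset) auto
  also have "\<dots> = poly_eval \<sigma> p + poly_eval \<sigma> q"
    by (simp add: poly_eval_superset[of ?S] lookup_add distrib_right sum.distrib)
  finally show ?thesis .
qed

lemma poly_eval_single: "poly_eval \<sigma> (Poly_Mapping.single m c) = c * mono_eval \<sigma> m"
  by (subst poly_eval_superset[of "{m}"]) auto

lemma poly_eval_mult: "poly_eval \<sigma> (p * q) = poly_eval \<sigma> p * poly_eval \<sigma> q"
proof (induction p rule: poly_mapping_add_induct)
  case (add m c p)
  have "poly_eval \<sigma> (Poly_Mapping.single m c * q) = c * mono_eval \<sigma> m * poly_eval \<sigma> q"
  proof (induction q rule: poly_mapping_add_induct)
    case (add n b q)
    then show ?case
      by (simp add: distrib_left poly_eval_add mult_single poly_eval_single mono_eval_add)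
  qed (simp add: poly_eval_0)
  with add show ?case
    by (simp add: distrib_right poly_eval_add poly_eval_single)
qed (simp add: poly_eval_0)

lemma poly_eval_1: "poly_eval \<sigma> 1 = 1"
  using poly_eval_single[of \<sigma> 0 1] by (simp add: mono_eval_def)

text \<open>The specialization acts on polynomials only, so the coefficients
  \<open>var_fun v\<close> of the generators need polynomial preimages.\<close>

definition var_poly :: "'n::finite var \<Rightarrow> 'n mpoly"
  where "var_poly v = Poly_Mapping.single (Poly_Mapping.single v 1) 1"

lemma poly_eval_var: "poly_eval \<sigma> (var_poly v) = \<sigma> v"
proof -
  have "mono_eval \<sigma> (Poly_Mapping.single v 1) = (\<Prod>w\<in>UNIV. if w = v then \<sigma> v else 1)"
    unfolding mono_eval_def by (intro prod.cong) (auto simp: lookup_single)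
  then show ?thesis
    by (simp add: var_poly_def poly_eval_single)
qed

lemma var_fun_eq: "var_fun v = poly_fun (var_poly v)"
  by (simp only: var_fun_def var_poly_def)

lemma poly_fun_add: "poly_fun (p + q) = poly_fun p + poly_fun q"
  unfolding poly_fun_def by (subst add_fract) (simp_all only: one_neq_zero not_False_eq_True mult_1_right mult_1_left)

lemma poly_fun_mult: "poly_fun (p * q) = poly_fun p * poly_fun q"
  unfolding poly_fun_def mult_fract by (simp only: mult_1_right)

lemma poly_fun_1: "poly_fun 1 = 1"
  by (simp only: poly_fun_def One_fract_def)

lemma poly_fun_eq_0: "poly_fun p = 0 \<longleftrightarrow> p = 0"
  unfolding poly_fun_def Zero_fract_def
  by (subst eq_fract) (simp_all only: one_neq_zero not_False_eq_True mult_1_right mult_zero_left)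

lemma ratfun_deriv_poly: "ratfun_deriv v (poly_fun p) = poly_fun (poly_deriv v p)"
proof -
  have "poly_deriv v 1 = 0"
    using poly_deriv_single[of v 0 1] by (simp add: mono_deriv_def)
  then show ?thesis
    unfolding poly_fun_def by (subst ratfun_deriv_Fract) (simp_all only: one_neq_zero not_False_eq_True mult_1_right mult_zero_right diff_zero)
qed

section \<open>Commutation of partial derivatives\<close>

lemma poly_deriv_commute: "poly_deriv v (poly_deriv w p) = poly_deriv w (poly_deriv v p)"
proof (induction p rule: poly_mapping_add_induct)
  case (add m c p)
  have "m - Poly_Mapping.single w 1 - Poly_Mapping.single v 1 = m - Poly_Mapping.single v 1 - Poly_Mapping.single w 1"
    by (rule poly_mapping_eqI) (simp add: lookup_minus)
  then have "poly_deriv v (mono_deriv w m c) = poly_deriv w (mono_deriv v m c)"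
    by (cases "v = w") (simp_all add: mono_deriv_def poly_deriv_single lookup_minus lookup_single mult_ac)
  with add show ?case
    by (simp add: poly_deriv_add poly_deriv_single)
qed simp

text \<open>With \<open>f * q = p\<close> for polynomials \<open>p\<close>, \<open>q\<close>, both
  mixed derivatives of the product agree. In the Leibniz expansion the products of first derivatives
  are symmetric in \<open>v\<close> and \<open>w\<close> and cancel, and so do the terms with second
  derivatives of \<open>q\<close>; a factor \<open>q\<close> is left to divide by.\<close>

lemma ratfun_deriv_commute: "ratfun_deriv v (ratfun_deriv w f) = ratfun_deriv w (ratfun_deriv v f)"
proof (cases f)
  fix p q :: "'a mpoly"
  assume f: "f = Fract p q" "q \<noteq> 0"
  have *: "f * poly_fun q = poly_fun p"
    unfolding f(1) poly_fun_def mult_fract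
    by (subst eq_fract) (simp_all only: f(2) one_neq_zero not_False_eq_True mult_1_right simp_thms)
  have "ratfun_deriv v (ratfun_deriv w (f * poly_fun q)) = ratfun_deriv w (ratfun_deriv v (f * poly_fun q))"
    unfolding * ratfun_deriv_poly poly_deriv_commute[of v w] ..
  then have "ratfun_deriv v (ratfun_deriv w f) * poly_fun q = ratfun_deriv w (ratfun_deriv v f) * poly_fun q"
    unfolding ratfun_deriv_mult ratfun_deriv_add ratfun_deriv_poly poly_deriv_commute[of v w]
    by (simp add: algebra_simps)
  moreover have "poly_fun q \<noteq> 0"
    using f(2) by (simp only: poly_fun_eq_0 not_False_eq_True)
  ultimately show ?thesis
    using mult_right_cancel by blast
qed

lemma pd_commute: "pd v * pd w = pd w * pd v"
  unfolding apply_op_inject[symmetric] fun_eq_iff times_diffop.rep_eq apply_pd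
  using ratfun_deriv_commute by blast

lemma coef_add: "coef (a + b) = coef a + coef b"
  unfolding apply_op_inject[symmetric] fun_eq_iff plus_diffop.rep_eq apply_coef
  by (simp only: distrib_right simp_thms)

lemma coef_0: "coef 0 = 0"
  using coef_add[of 0 0] by (simp only: add_0_left add_cancel_right_right)

lemma coef_mult: "coef (a * b) = coef a * coef b"
  unfolding apply_op_inject[symmetric] fun_eq_iff times_diffop.rep_eq apply_coef
  by (simp only: mult.assoc simp_thms)

lemma coef_1: "coef 1 = 1"
  unfolding apply_op_inject[symmetric] fun_eq_iff one_diffop.rep_eq apply_coef
  by (simp only: mult_1_left simp_thms)

section \<open>Common denominators and factored forms\<close>

lemma common_denominator:
  fixes S :: "'n::finite ratfun set"
  assumes "finite S"
  shows "\<exists>q. q \<noteq> 0 \<and> (\<forall>f\<in>S. poly_fun q * f \<in> range poly_fun)"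
  using assms
proof (induction S rule: finite_induct)
  case empty
  then show ?case
    by (auto intro: exI[of _ 1])
next
  case (insert f S)
  then obtain q where q: "q \<noteq> 0" "\<And>g. g \<in> S \<Longrightarrow> poly_fun q * g \<in> range poly_fun"
    by blast
  obtain a b where f: "f = Fract a b" "b \<noteq> 0"
    by (cases f)
  have b: "poly_fun b * f = poly_fun a"
    unfolding f(1) poly_fun_def mult_fract
    by (subst eq_fract) (simp_all only: f(2) one_neq_zero not_False_eq_True mult_1_right mult_1_left simp_thms mult.commute)
  have "poly_fun (b * q) * g \<in> range poly_fun" if g: "g \<in> insert f S" for g
  proof (cases "g = f")
    case True
    have "poly_fun (b * q) * f = poly_fun q * (poly_fun b * f)"
      by (simp only: poly_fun_mult mult_ac)
    then show ?thesis
      unfolding True b poly_fun_mult[symmetric] by (simp only: rangeI)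
  next
    case False
    with g q(2) obtain p where "poly_fun q * g = poly_fun p"
      by blast
    then have "poly_fun (b * q) * g = poly_fun (b * p)"
      by (simp only: poly_fun_mult mult.assoc)
    then show ?thesis
      by (simp only: rangeI)
  qed
  moreover have "b * q \<noteq> 0"
    using q(1) f(2) by (simp only: mult_eq_0_iff simp_thms not_False_eq_True)
  ultimately show ?case
    by blast
qed

lemma has_factored_form_carrier:
  fixes H :: "'n::finite ratfun mat"
  assumes H: "H \<in> carrier_mat N N"
  shows "has_factored_form N H"
proof -
  have "elements_mat H = (\<lambda>(i, j). H $$ (i, j)) ` ({..<dim_row H} \<times> {..<dim_col H})"
    by (auto simp: elements_mat_def)
  then have "finite (elements_mat H)"
    by simp
  then obtain q where q: "q \<noteq> 0" "\<And>f. f \<in> elements_mat H \<Longrightarrow> poly_fun q * f \<in> range poly_fun"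
    using common_denominator[of "elements_mat H"] by blast
  let ?q = "poly_fun q"
  have nz: "?q \<noteq> 0"
    using q(1) by (simp only: poly_fun_eq_0 not_False_eq_True)
  let ?A = "?q \<cdot>\<^sub>m 1\<^sub>m N" and ?A' = "inverse ?q \<cdot>\<^sub>m 1\<^sub>m N :: 'n ratfun mat" and ?Q = "?q \<cdot>\<^sub>m H"
  \<comment> \<open>The off-diagonal entries of \<open>?A\<close> are zero and have to be recognized
    as polynomials.\<close>
  have range: "0 \<in> range (poly_fun :: 'n mpoly \<Rightarrow> _)"
    using poly_fun_eq_0 by (metis rangeI)
  have A: "?A \<in> poly_mats N"
    using range by (auto simp: poly_mats_def elements_mat_def)
  have Q: "?Q \<in> poly_mats N"
    using H q(2) by (auto simp: poly_mats_def elements_mat_def)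
  have "?A * ?A' = 1\<^sub>m N" "?A' * ?A = 1\<^sub>m N"
    using nz by (auto simp: mult_smult_assoc_mat[of _ N N _ N] mult_smult_distrib[of _ N N _ N]
        intro!: eq_matI)
  then have "inverts_mat ?A ?A'" "inverts_mat ?A' ?A"
    by (simp_all add: inverts_mat_def)
  then have 1: "?A' * ?Q \<in> factored_products N"
    using A Q by (intro factored_products.single) simp_all
  have "?A' * ?Q = H"
    using H nz by (auto simp: mult_smult_assoc_mat[of _ N N _ N] intro!: eq_matI)
  with 1 H show ?thesis
    unfolding has_factored_form_def by (intro exI[of _ "[H]"]) simp
qed

section \<open>The span of the Fisher--Bingham vector\<close>

definition FB_comb :: "(nat \<Rightarrow> 'n ratfun) \<Rightarrow> 'n::{finite,linorder} diffop"
  where "FB_comb h = (\<Sum>k<dim_vec (FB_vec :: 'n diffop vec). coef (h k) * FB_vec $ k)"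

text \<open>The preimage, in the ring of operators, of the span of the entries of
  \<open>FB_vec\<close> modulo the ideal. Closure under rational functions is immediate; that the
  derivatives \<open>dy i\<close> carry the entries back into it is what has to be proved.\<close>

definition FB_span :: "nat \<Rightarrow> 'n::{finite,linorder} diffop set"
  where "FB_span d = {P. \<exists>h. P - FB_comb h \<in> FB_ideal d}"

lemma left_ideal_FB_ideal: "left_ideal (FB_ideal d)"
  unfolding FB_ideal_def by (rule hull_in) (auto simp: left_ideal_def)

lemma FB_ideal_add: "P \<in> FB_ideal d \<Longrightarrow> Q \<in> FB_ideal d \<Longrightarrow> P + Q \<in> FB_ideal d"
  and FB_ideal_mult: "P \<in> FB_ideal d \<Longrightarrow> A * P \<in> FB_ideal d"
  and FB_ideal_0: "0 \<in> FB_ideal d"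
  using left_ideal_FB_ideal[of d] unfolding left_ideal_def by blast+

lemma FB_spanI: "P - FB_comb h \<in> FB_ideal d \<Longrightarrow> P \<in> FB_span d"
  unfolding FB_span_def by blast

lemma FB_span_ideal: "P \<in> FB_ideal d \<Longrightarrow> P \<in> FB_span d"
  by (rule FB_spanI[of _ "\<lambda>_. 0"]) (simp add: FB_comb_def coef_0)

lemma FB_span_vec:
  assumes "k < dim_vec (FB_vec :: 'a::{finite,linorder} diffop vec)"
  shows "(FB_vec :: 'a diffop vec) $ k \<in> FB_span d"
proof (rule FB_spanI)
  have "FB_comb (\<lambda>l. if l = k then 1 else 0) =
      (\<Sum>l<dim_vec (FB_vec :: 'a diffop vec). if l = k then FB_vec $ k else 0 :: 'a diffop)"
    unfolding FB_comb_def by (intro sum.cong) (simp_all add: coef_0 coef_1)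
  also have "\<dots> = FB_vec $ k"
    using assms by simp
  finally show "(FB_vec :: 'a diffop vec) $ k - FB_comb (\<lambda>l. if l = k then 1 else 0) \<in> FB_ideal d"
    by (simp add: FB_ideal_0)
qed

lemma FB_span_add:
  assumes "P \<in> FB_span d" "Q \<in> FB_span d"
  shows "P + Q \<in> FB_span d"
proof -
  obtain h g where "P - FB_comb h \<in> FB_ideal d"
    and "Q - FB_comb g \<in> FB_ideal d"
    using assms unfolding FB_span_def by blast
  from FB_ideal_add[OF this] show ?thesis
    by (intro FB_spanI[of _ "\<lambda>k. h k + g k"])
      (simp add: FB_comb_def coef_add distrib_right sum.distrib algebra_simps)
qed

lemma FB_span_mult:
  assumes "P \<in> FB_span d"
  shows "coef c * P \<in> FB_span d"
proof -
  obtain h where "P - FB_comb h \<in> FB_ideal d"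
    using assms unfolding FB_span_def by blast
  from FB_ideal_mult[OF this, of "coef c"] show ?thesis
    by (intro FB_spanI[of _ "\<lambda>k. c * h k"])
      (simp add: FB_comb_def coef_mult right_diff_distrib sum_distrib_left mult.assoc)
qed

section \<open>The specialization point\<close>

text \<open>The diagonal variables get pairwise distinct values because \<open>to_nat\<close> is
  injective. The \<open>SOME\<close> is unambiguous, since \<open>Upair i i\<close> determines
  \<open>i\<close>.\<close>

definition diag_point :: "'n::finite var \<Rightarrow> rat"
  where "diag_point v = (case v of
    Var_x e \<Rightarrow> if \<exists>i. e = Upair i i then of_nat (to_nat (SOME i. e = Upair i i)) else 0
  | _ \<Rightarrow> 0)"

lemma diag_point_diag: "diag_point (Var_x (Upair i i)) = of_nat (to_nat i)"
  by (simp add: diag_point_def)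

lemma diag_point_offdiag: "i \<noteq> j \<Longrightarrow> diag_point (Var_x (Upair i j)) = 0"
  by (auto simp: diag_point_def)

interpretation FB: specialized_module "poly_eval diag_point" "\<lambda>p. coef (poly_fun p)"
  "FB_span d :: 'n::{finite,linorder} diffop set" for d
proof
  fix P :: "'n diffop" and p :: "'n mpoly"
  assume P: "coef (poly_fun p) * P \<in> FB_span d" and p: "poly_eval diag_point p \<noteq> 0"
  \<comment> \<open>A polynomial that does not vanish at the point is nonzero, hence a unit in the
    field of rational functions.\<close>
  have "p \<noteq> 0"
    using p poly_eval_0 by blast
  then have "poly_fun p \<noteq> 0"
    by (simp only: poly_fun_eq_0 not_False_eq_True)
  then have "inverse (poly_fun p) * poly_fun p = 1"
    by (rule left_inverse)
  then have "coef (inverse (poly_fun p)) * (coef (poly_fun p) * P) = P"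
    by (simp only: mult.assoc[symmetric] coef_mult[symmetric] coef_1 mult_1_left)
  with FB_span_mult[OF P, of "inverse (poly_fun p)"] show "P \<in> FB_span d"
    by (simp only:)
next
  show "0 \<in> FB_span d"
    by (intro FB_span_ideal FB_ideal_0)
qed (simp_all only: poly_eval_add poly_eval_mult poly_eval_1 poly_fun_add poly_fun_mult poly_fun_1
    coef_add coef_mult coef_1 FB_span_add FB_span_mult)

text \<open>The second-order part of generator (3), which reflects the infinitesimal rotation in the
  plane of the coordinates \<open>i\<close> and \<open>j\<close>. The split isolates the terms whose
  coefficients are free of the variables \<open>Var_y\<close>.\<close>

definition rot_op :: "'n::{finite,linorder} \<Rightarrow> 'n \<Rightarrow> 'n diffop"
  where "rot_op i j = x_op i j * dy i ^ 2 + 2 * (x_op j j - x_op i i) * dy i * dy j - x_op i j * dy j ^ 2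
      + (\<Sum>k\<in>UNIV - {i, j}. x_op k j * dy i * dy k - x_op i k * dy j * dy k)"

lemma FB_gen3_ideal: "i < j \<Longrightarrow> rot_op i j + y_op j * dy i - y_op i * dy j \<in> FB_ideal d"
  unfolding FB_ideal_def FB_gen3_def rot_op_def by (rule hull_inc) blast

lemma FB_gen2_ideal: "FB_gen2 \<in> FB_ideal d"
  unfolding FB_ideal_def by (rule hull_inc) blast

lemma dy_x_op: "dy c * x_op i j = x_op i j * dy c"
  unfolding pd_coef ratfun_deriv_var by (simp add: coef_0)

lemma dy_r_op: "dy c * r_op = r_op * dy c"
  unfolding pd_coef ratfun_deriv_var by (simp add: coef_0)

text \<open>The centralizer \<open>C\<close> of \<open>dy c\<close> is closed under ring operations
  and contains the building blocks of \<open>rot_op\<close>: the number 2, the derivatives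
  \<open>dy k\<close>, and the \<open>x_op k l\<close>, which do not depend on the variables
  \<open>Var_y\<close>.\<close>

lemma dy_rot_op: "dy c * rot_op i j = rot_op i j * dy c"
proof -
  define C where "C = {P. dy c * P = P * dy c}"
  have C_add: "P + Q \<in> C" and C_diff: "P - Q \<in> C" and C_mult: "P * Q \<in> C"
    if "P \<in> C" "Q \<in> C" for P Q
  proof -
    have "dy c * (P * Q) = P * Q * dy c"
      using that by (metis (mono_tags, lifting) C_def mem_Collect_eq mult.assoc)
    with that show "P + Q \<in> C" "P - Q \<in> C" "P * Q \<in> C"
      by (simp_all add: C_def algebra_simps)
  qed
  have C_sum: "sum f A \<in> C" if "\<And>k. k \<in> A \<Longrightarrow> f k \<in> C" for f and A :: "'a set"
    using that by (simp add: C_def sum_distrib_left sum_distrib_right)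
  have "2 \<in> C" "dy k \<in> C" "x_op k l \<in> C" for k l
    by (simp_all add: C_def mult_2 mult_2_right pd_commute dy_x_op)
  then have "rot_op i j \<in> C"
    unfolding rot_op_def power2_eq_square
    by (intro C_add C_diff C_mult C_sum)
  then show ?thesis
    by (simp add: C_def)
qed

section \<open>Entries of the Fisher--Bingham vector\<close>

lemma FB_vec_eq:
  "FB_vec = vec_of_list (1 # map dy (sorted_list_of_set UNIV) @
    map (\<lambda>i. dy i ^ 2) (butlast (sorted_list_of_set UNIV)))"
  by (simp only: FB_vec_def Let_def)

lemma dim_FB_vec: "dim_vec (FB_vec :: 'n::{finite,linorder} diffop vec) = 2 * CARD('n)"
proof -
  \<comment> \<open>For \<open>n = CARD('n)\<close> the length is \<open>1 + n + (n - 1)\<close>,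
    which equals \<open>2 * n\<close> only for positive \<open>n\<close> because of truncated
    subtraction.\<close>
  have "CARD('n) > 0"
    by simp
  then show ?thesis
    by (simp add: FB_vec_eq)
qed

lemma FB_vec_entries:
  "(\<exists>k<dim_vec (FB_vec :: 'n::{finite,linorder} diffop vec). FB_vec $ k = P) \<longleftrightarrow>
    P = 1 \<or> P \<in> range dy \<or> P \<in> (\<lambda>i :: 'n. dy i ^ 2) ` set (butlast (sorted_list_of_set UNIV))"
proof -
  let ?L = "1 # map dy (sorted_list_of_set UNIV) @
    map (\<lambda>i :: 'n. dy i ^ 2) (butlast (sorted_list_of_set UNIV))"
  have "(\<exists>k<dim_vec (FB_vec :: 'n diffop vec). FB_vec $ k = P) \<longleftrightarrow> P \<in> set ?L"
    unfolding FB_vec_eq in_set_conv_nth dim_vec_of_list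
    by (auto simp only: vec_of_list_index)
  also have "\<dots> \<longleftrightarrow> P = 1 \<or> P \<in> range dy \<or>
      P \<in> (\<lambda>i :: 'n. dy i ^ 2) ` set (butlast (sorted_list_of_set UNIV))"
    by simp
  finally show ?thesis .
qed

lemma FB_span_entry:
  "\<exists>k<dim_vec (FB_vec :: 'n::{finite,linorder} diffop vec). FB_vec $ k = P \<Longrightarrow>
    P \<in> (FB_span d :: 'n diffop set)"
  using FB_span_vec by blast

lemma FB_span_1: "1 \<in> FB_span d"
  by (rule FB_span_entry) (simp add: FB_vec_entries)

lemma FB_span_dy: "dy i \<in> FB_span d"
  by (rule FB_span_entry) (simp add: FB_vec_entries)

text \<open>All squares but the last are entries of \<open>FB_vec\<close>; generator (2) expresses
  the last one through the others and \<open>r_op * r_op\<close> times the entry 1.\<close>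

lemma FB_span_dy_square: "dy i * dy i \<in> FB_span d"
proof -
  let ?L = "sorted_list_of_set (UNIV :: 'a set)"
  have L: "?L = butlast ?L @ [last ?L]"
    by (subst append_butlast_last_id) simp_all
  have square: "dy j * dy j \<in> FB_span d" if "j \<noteq> last ?L" for j
  proof -
    have "j \<in> set ?L"
      by simp
    then have "j \<in> set (butlast ?L)"
      using that by (metis L Un_iff empty_iff empty_set list.simps(15) set_append insert_iff)
    then show ?thesis
      by (intro FB_span_entry) (auto simp: FB_vec_entries power2_eq_square)
  qed
  show ?thesis
  proof (cases "i = last ?L")
    case True
    have "(\<Sum>j\<in>UNIV - {i}. dy j * dy j) \<in> FB_span d"
      using square True by (intro FB.W_sum) auto
    then have "FB_gen2 - (\<Sum>j\<in>UNIV - {i}. dy j * dy j) + coef (var_fun Var_r * var_fun Var_r) * 1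
        \<in> FB_span d"
      by (intro FB.W_add FB.W_diff FB_span_mult FB_span_1 FB_span_ideal[OF FB_gen2_ideal])
    also have "FB_gen2 = dy i * dy i + (\<Sum>j\<in>UNIV - {i}. dy j * dy j) - r_op * r_op"
      unfolding FB_gen2_def power2_eq_square by (subst sum.remove[of _ i]) simp_all
    finally show ?thesis
      by (simp add: coef_mult)
  qed (rule square)
qed

section \<open>Elimination of the monomials of order two and three\<close>

text \<open>Except for \<open>2 * (x_op j j - x_op i i) * dy i * dy j\<close>, every term of
  \<open>rot_op i j\<close> has an off-diagonal coefficient, which vanishes at
  \<open>diag_point\<close>. The remaining coefficient is nonzero there and can be cancelled. The
  factor \<open>M\<close> is 1 for second-order monomials and a derivative for third-order
  ones.\<close>

lemma rot_op_residual:
  fixes i j :: "'n::{finite,linorder}"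
  assumes "finite U" "i < j" "rot_op i j * M \<in> FB_span d"
    and U: "\<And>k l. dy k * dy l * M \<in> U"
  shows "dy i * dy j * M \<in> FB.residual d U"
proof -
  define X :: "'n \<Rightarrow> 'n \<Rightarrow> 'n mpoly" where "X k l = var_poly (Var_x (Upair k l))" for k l
  have x_op: "x_op k l = coef (poly_fun (X k l))" for k l
    by (simp only: X_def var_fun_eq)
  have off: "x_op k l * (dy p * dy q * M) \<in> FB.residual d U" if "k \<noteq> l" for k l p q
    unfolding x_op using that assms(1) U
    by (intro FB.residual_gen) (simp_all add: X_def poly_eval_var diag_point_offdiag)
  \<comment> \<open>The factor 2 is written as a sum, so that additivity of the embedding and of the
    evaluation suffices.\<close>
  have p: "2 * (x_op j j - x_op i i) = coef (poly_fun ((X j j - X i i) + (X j j - X i i)))"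
    by (simp only: x_op FB.e_diff FB.e_add mult_2)
  have nz: "poly_eval diag_point ((X j j - X i i) + (X j j - X i i)) \<noteq> 0"
    unfolding FB.s_add FB.s_diff X_def poly_eval_var diag_point_diag
    using assms(2) by simp
  have "2 * (x_op j j - x_op i i) * (dy i * dy j * M) =
      rot_op i j * M - x_op i j * (dy i * dy i * M) + x_op i j * (dy j * dy j * M)
      - (\<Sum>k\<in>UNIV - {i, j}. x_op k j * (dy i * dy k * M) - x_op i k * (dy j * dy k * M))"
    unfolding rot_op_def power2_eq_square
    by (simp only: distrib_right left_diff_distrib sum_distrib_right mult.assoc) simp
  also have "\<dots> \<in> FB.residual d U"
    using assms(2) FB.residual_W[OF assms(3)]
    by (intro FB.residual_add FB.residual_diff FB.residual_sum off) auto
  finally show ?thesis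
    unfolding p using nz by (rule FB.residual_cancel)
qed

lemma rot_op_span:
  assumes "i < j"
  shows "rot_op i j \<in> FB_span d"
proof -
  have "(rot_op i j + y_op j * dy i - y_op i * dy j) - y_op j * dy i + y_op i * dy j \<in> FB_span d"
    by (intro FB.W_add FB.W_diff FB_span_mult FB_span_dy FB_span_ideal FB_gen3_ideal assms)
  then show ?thesis
    by simp
qed

lemma FB_span_dy2: "dy i * dy j \<in> FB_span d"
proof -
  \<comment> \<open>The squares are included because \<open>rot_op_residual\<close> needs all
    products; they are in the span already.\<close>
  let ?U = "range (\<lambda>(i, j). dy i * dy j) :: 'a diffop set"
  have U: "dy k * dy l \<in> ?U" for k l
    by auto
  have less: "dy k * dy l * 1 \<in> FB.residual d ?U" if "k < l" for k l
    using that U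
    by (intro rot_op_residual) (simp_all add: rot_op_span)
  have "dy k * dy l \<in> FB.residual d ?U" for k l
    using less[of k l] less[of l k] pd_commute[of "Var_y k" "Var_y l"]
    by (cases k l rule: linorder_cases) (simp_all add: FB.residual_W FB_span_dy_square)
  then have "?U \<subseteq> FB_span d"
    by (intro FB.nakayama) auto
  then show ?thesis
    using U by blast
qed

text \<open>Multiply generator (3) by \<open>dy k\<close> on the left and move \<open>dy k\<close>
  past \<open>rot_op i j\<close>. The lower terms have order at most two, where differentiating
  \<open>y_op p\<close> contributes a first-order term, so \<open>FB_span_dy2\<close> covers
  them.\<close>

lemma rot_op_dy_span:
  assumes "i < j"
  shows "rot_op i j * dy k \<in> FB_span d"
proof -
  have y: "dy k * (y_op p * dy q) \<in> FB_span d" for p q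
  proof -
    have "dy k * (y_op p * dy q) =
        y_op p * (dy k * dy q) + coef (ratfun_deriv (Var_y k) (var_fun (Var_y p))) * dy q"
      unfolding mult.assoc[symmetric] pd_coef distrib_right ..
    then show ?thesis
      by (simp only: FB.W_add FB_span_mult FB_span_dy FB_span_dy2)
  qed
  have "dy k * (rot_op i j + y_op j * dy i - y_op i * dy j) - dy k * (y_op j * dy i)
      + dy k * (y_op i * dy j) \<in> FB_span d"
    by (intro FB.W_add FB.W_diff y FB_span_ideal[OF FB_ideal_mult] FB_gen3_ideal assms)
  then show ?thesis
    by (simp add: distrib_left right_diff_distrib dy_rot_op)
qed

text \<open>Monomials with two different indices come from \<open>rot_op_residual\<close> with a
  derivative as \<open>M\<close>. For the cubes, \<open>dy p\<close> times generator (2) makes the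
  sum of all \<open>dy p * (dy q * dy q)\<close> congruent to \<open>r_op * r_op * dy p\<close>, and
  its terms with \<open>q\<close> different from \<open>p\<close> are mixed.\<close>

lemma FB_span_dy3: "dy i * dy j * dy k \<in> FB_span d"
proof -
  let ?U = "range (\<lambda>(i, j, k). dy i * dy j * dy k) :: 'a diffop set"
  let ?N = "FB.residual d ?U"
  have U: "dy p * dy q * dy s \<in> ?U" for p q s
    by (rule range_eqI[of _ _ "(p, q, s)"]) simp
  have swap: "dy p * dy q * dy s = dy p * dy s * dy q" for p q s :: 'a
    by (simp only: mult.assoc pd_commute)
  have less: "dy p * dy q * dy s \<in> ?N" if "p < q" for p q s
    using that U by (intro rot_op_residual) (simp_all add: rot_op_dy_span)
  have neq: "dy p * dy q * dy s \<in> ?N" if "p \<noteq> q" for p q s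
    using that less[of p q] less[of q p] pd_commute[of "Var_y p" "Var_y q"]
    by (cases p q rule: linorder_cases) simp_all
  have cube: "dy p * dy p * dy p \<in> ?N" for p :: 'a
  proof -
    have r: "dy p * (r_op * r_op) = r_op * r_op * dy p"
      by (metis dy_r_op mult.assoc)
    have "(\<Sum>q\<in>UNIV. dy p * (dy q * dy q)) = dy p * FB_gen2 + r_op * r_op * dy p"
      unfolding FB_gen2_def power2_eq_square right_diff_distrib sum_distrib_left r by simp
    also have "\<dots> \<in> FB_span d"
      unfolding coef_mult[symmetric]
      by (intro FB.W_add FB_span_mult FB_span_dy FB_span_ideal[OF FB_ideal_mult] FB_gen2_ideal)
    finally have "(\<Sum>q\<in>UNIV. dy p * (dy q * dy q)) - (\<Sum>q\<in>UNIV - {p}. dy p * dy q * dy q) \<in> ?N"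
      by (intro FB.residual_diff FB.residual_W FB.residual_sum neq) auto
    then show ?thesis
      by (subst (asm) sum.remove[of _ p]) (simp_all add: mult.assoc)
  qed
  \<comment> \<open>The relation \<open>neq\<close> compares only the first two factors;
    \<open>swap\<close> brings a differing third index into second place.\<close>
  have "dy p * dy q * dy s \<in> ?N" for p q s
  proof (cases "p = q")
    case True
    then show ?thesis
      using cube[of p] neq[of p s q] swap[of p q s] by (cases "p = s") simp_all
  qed (rule neq)
  then have "?U \<subseteq> FB_span d"
    by (intro FB.nakayama) auto
  then show ?thesis
    using U by blast
qed

theorem theorem1:
  fixes d :: nat and i :: "'n::{finite,linorder}"
  assumes "d \<ge> 1" and "CARD('n) = d + 1"
  shows "\<exists>H :: 'n ratfun mat. H \<in> carrier_mat (2 * d + 2) (2 * d + 2) \<and>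
    has_factored_form (2 * d + 2) H \<and>
    cong_mod (FB_ideal d) (dy i \<cdot>\<^sub>v FB_vec) (map_mat coef H *\<^sub>v FB_vec)"
proof -
  let ?F = "FB_vec :: 'n diffop vec"
  have dim: "dim_vec ?F = 2 * d + 2"
    using assms(2) by (simp add: dim_FB_vec)
  have "dy i * ?F $ k \<in> FB_span d" if "k < 2 * d + 2" for k
  proof -
    have "?F $ k = 1 \<or> ?F $ k \<in> range dy \<or> ?F $ k \<in> range (\<lambda>j. dy j ^ 2)"
      using FB_vec_entries[of "?F $ k"] that dim by auto
    then show ?thesis
      by (auto simp: power2_eq_square mult.assoc[symmetric] FB_span_dy FB_span_dy2 FB_span_dy3)
  qed
  \<comment> \<open>The bound on \<open>k\<close> sits inside the existential so that choice yields
    a total \<open>h\<close>; its value at \<open>k\<close> supplies row \<open>k\<close> of the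
    matrix.\<close>
  then have "\<forall>k. \<exists>h. k < 2 * d + 2 \<longrightarrow> dy i * ?F $ k - FB_comb h \<in> FB_ideal d"
    unfolding FB_span_def by blast
  then obtain h where h: "\<And>k. k < 2 * d + 2 \<Longrightarrow> dy i * ?F $ k - FB_comb (h k) \<in> FB_ideal d"
    by metis
  define H where "H = mat (2 * d + 2) (2 * d + 2) (\<lambda>(k, l). h k l)"
  have H: "H \<in> carrier_mat (2 * d + 2) (2 * d + 2)"
    by (simp add: H_def)
  have "(map_mat coef H *\<^sub>v ?F) $ k = FB_comb (h k)" if "k < 2 * d + 2" for k
    using that by (simp add: H_def scalar_prod_def FB_comb_def dim lessThan_atLeast0)
  with h H dim have "cong_mod (FB_ideal d) (dy i \<cdot>\<^sub>v ?F) (map_mat coef H *\<^sub>v ?F)"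
    by (simp add: cong_mod_def)
  with H show ?thesis
    using has_factored_form_carrier by blast
qed

end
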